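(* Consider the CNL-based expected captured demand when the competitor's facilities do not share the cross-nested structure with the new facilities, i.e. $$F(x)=\sum_{t\in[T]}q_t\,\frac{\sum_{n\in[N]}W_{tn}(x)^{\sigma_{tn}}}{U^c_t+\sum_{n\in[N]}W_{tn}(x)^{\sigma_{tn}}}=\sum_{t\in[T]}q_t-\sum_{t\in[T]}\frac{q_tU^c_t}{U^c_t+\sum_{n\in[N]}W_{tn}(x)^{\sigma_{tn}}},$$ where $W_{tn}(x)=\sum_{i\in[m]}\alpha^t_{in}V_{tin}x_i$. Then $F$, as a function of $x\in[0,1]^m$, is monotonically increasing (nondecreasing in each $x_i$) and concave in $x$.
   Context: Notation: $[k]=\{1,\dots,k\}$. $[T]$ is the set of customer types, $[m]$ the set of candidate locations, $[N]$ indexes the nests; $q_t>0$ is the demand of type $t$; $\sigma_{tn}\in(0,1]$ are dissimilarity parameters; $\alpha^t_{in}\ge 0$ with $\sum_{n\in[N]}\alpha^t_{in}=1$ are membership values of location $i$ in nest $n$ for type $t$; $V_{tin}=e^{v_{ti}/\sigma_{tn}}>0$ with $v_{ti}\in\mathbb{R}$ the deterministic utilities. Since no competitor facility belongs to a nest containing a new facility, the competitor contributes only through a constant $U^c_t>0$ (its total exponentiated utility) in the denominator, and $W_{tn}(x)$ involves only the new facilities. Powers satisfy $0^{\sigma}=0$ for $\sigma>0$. *)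

theory Defs
  imports "HOL-Analysis.Analysis"
begin

text \<open>
  The finite types \<open>'t\<close>, \<open>'m\<close> and \<open>'n\<close> index the customer types, the candidate locations and
  the nests.  Argument order follows the subscripts: \<open>v t i\<close>, \<open>\<sigma> t n\<close>, and \<open>\<alpha> t i n\<close> for the
  membership of location \<open>i\<close> in nest \<open>n\<close> for type \<open>t\<close>.
\<close>

definition unit_cube :: "(real ^ 'm) set" where
  "unit_cube = {x. \<forall>i. 0 \<le> x $ i \<and> x $ i \<le> 1}"

definition cnl_V :: "('t \<Rightarrow> 'n \<Rightarrow> real) \<Rightarrow> ('t \<Rightarrow> 'm \<Rightarrow> real) \<Rightarrow> 't \<Rightarrow> 'm \<Rightarrow> 'n \<Rightarrow> real" where
  "cnl_V \<sigma> v t i n = exp (v t i / \<sigma> t n)"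

definition cnl_W ::
  "('t \<Rightarrow> 'n \<Rightarrow> real) \<Rightarrow> ('t \<Rightarrow> 'm \<Rightarrow> 'n \<Rightarrow> real) \<Rightarrow> ('t \<Rightarrow> 'm \<Rightarrow> real) \<Rightarrow>
   't \<Rightarrow> 'n \<Rightarrow> real ^ 'm::finite \<Rightarrow> real" where
  "cnl_W \<sigma> \<alpha> v t n x = (\<Sum>i\<in>UNIV. \<alpha> t i n * cnl_V \<sigma> v t i n * x $ i)"

text \<open>
  On the unit cube every \<open>cnl_W\<close> is nonnegative, and \<open>powr\<close> follows the convention
  \<open>0 powr s = 0\<close>.
\<close>

definition cnl_inclusive ::
  "('t \<Rightarrow> 'n::finite \<Rightarrow> real) \<Rightarrow> ('t \<Rightarrow> 'm \<Rightarrow> 'n \<Rightarrow> real) \<Rightarrow> ('t \<Rightarrow> 'm \<Rightarrow> real) \<Rightarrow>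
   't \<Rightarrow> real ^ 'm::finite \<Rightarrow> real" where
  "cnl_inclusive \<sigma> \<alpha> v t x = (\<Sum>n\<in>UNIV. cnl_W \<sigma> \<alpha> v t n x powr \<sigma> t n)"

definition captured_demand ::
  "('t::finite \<Rightarrow> real) \<Rightarrow> ('t \<Rightarrow> real) \<Rightarrow> ('t \<Rightarrow> 'n::finite \<Rightarrow> real) \<Rightarrow>
   ('t \<Rightarrow> 'm \<Rightarrow> 'n \<Rightarrow> real) \<Rightarrow> ('t \<Rightarrow> 'm \<Rightarrow> real) \<Rightarrow> real ^ 'm::finite \<Rightarrow> real" where
  "captured_demand q U \<sigma> \<alpha> v x =
     (\<Sum>t\<in>UNIV. q t * (cnl_inclusive \<sigma> \<alpha> v t x / (U t + cnl_inclusive \<sigma> \<alpha> v t x)))"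

end

theory Submission
  imports Defs
begin

text \<open>
  Concavity survives postcomposition with a nondecreasing concave function.  Each
  \<open>cnl_W\<close> is linear and nonnegative on the cube, so its power with exponent at most \<open>1\<close>
  is concave; these powers are summed, and the sum is fed into the nondecreasing concave
  function \<open>w \<mapsto> w / (u + w)\<close> on \<open>{0..}\<close>.
\<close>

lemma concave_on_compose_mono:
  fixes f :: "'a::real_vector \<Rightarrow> real" and g :: "real \<Rightarrow> real"
  assumes f: "concave_on S f" and g: "concave_on T g" and mono: "mono_on T g"
    and maps: "f \<in> S \<rightarrow> T"
  shows "concave_on S (\<lambda>x. g (f x))"
  unfolding concave_on_iff
proof (intro conjI ballI allI impI)
  show S: "convex S"
    using f by (rule concave_on_imp_convex)
  fix x y and a b :: real
  assume *: "x \<in> S" "y \<in> S" "0 \<le> a" "0 \<le> b" "a + b = 1"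
  \<comment> \<open>Monotonicity is only known on \<open>T\<close>, so both points to be compared
    must lie there: the value of \<open>f\<close> at the combination by \<open>maps\<close>, the
    combination of the values by convexity of \<open>T\<close>.\<close>
  have T: "f x \<in> T" "f y \<in> T" "f (a *\<^sub>R x + b *\<^sub>R y) \<in> T" "a * f x + b * f y \<in> T"
    using * maps convexD[OF S] convexD[OF concave_on_imp_convex[OF g], of "f x" "f y" a b]
    by auto
  have "a * g (f x) + b * g (f y) \<le> g (a * f x + b * f y)"
    using g * T by (auto simp: concave_on_iff)
  also have "\<dots> \<le> g (f (a *\<^sub>R x + b *\<^sub>R y))"
    using f * T by (intro mono_onD[OF mono]) (auto simp: concave_on_iff)
  finally show "a * g (f x) + b * g (f y) \<le> g (f (a *\<^sub>R x + b *\<^sub>R y))" .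
qed

lemma concave_on_sum_fun:
  fixes f :: "'i \<Rightarrow> 'a::real_vector \<Rightarrow> real"
  assumes "convex S" "\<And>i. i \<in> I \<Longrightarrow> concave_on S (f i)"
  shows "concave_on S (\<lambda>x. \<Sum>i\<in>I. f i x)"
  \<comment> \<open>For infinite \<open>I\<close> the sum defaults to \<open>0\<close>, so that
    case, like the empty one, is a constant function.\<close>
  using assms(2)
  by (induction I rule: infinite_finite_induct)
    (auto simp: concave_on_const assms(1) intro!: concave_on_add)

lemma mono_on_sum_fun:
  fixes f :: "'i \<Rightarrow> 'a::order \<Rightarrow> real"
  assumes "\<And>i. i \<in> I \<Longrightarrow> mono_on S (f i)"
  shows "mono_on S (\<lambda>x. \<Sum>i\<in>I. f i x)"
  using assms by (auto simp: monotone_on_def intro!: sum_mono)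

lemma mono_on_powr:
  fixes s :: real
  assumes "0 \<le> s"
  shows "mono_on {0..} (\<lambda>x::real. x powr s)"
  using assms by (auto intro!: mono_onI powr_mono2)

text \<open>On the open half-line the second derivative is nonpositive. For \<open>0 < s < 1\<close>
  the first derivative blows up at \<open>0\<close>, so segments starting at that endpoint get a
  direct argument.\<close>

lemma concave_on_powr:
  fixes s :: real
  assumes s: "0 \<le> s" "s \<le> 1"
  shows "concave_on {0..} (\<lambda>x::real. x powr s)"
proof (rule concave_on_linorderI)
  have pos: "concave_on {0<..} (\<lambda>x::real. x powr s)"
  proof (rule f''_le0_imp_concave)
    fix x :: real
    assume "x \<in> {0<..}"
    then show "((\<lambda>x. x powr s) has_real_derivative s * x powr (s - 1)) (at x)"
      and "((\<lambda>x. s * x powr (s - 1)) has_real_derivative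
            s * ((s - 1) * x powr (s - 1 - 1))) (at x)"
      by (auto intro!: derivative_eq_intros)
    show "s * ((s - 1) * x powr (s - 1 - 1)) \<le> 0"
      using s by (intro mult_nonneg_nonpos mult_nonpos_nonneg) auto
  qed auto
  fix t x y :: real
  assume t: "0 < t" "t < 1" and xy: "x \<in> {0..}" "y \<in> {0..}" "x < y"
  show "(1 - t) * x powr s + t * y powr s \<le> ((1 - t) *\<^sub>R x + t *\<^sub>R y) powr s"
  proof (cases "x = 0")
    case True
    \<comment> \<open>As \<open>0 powr s = 0\<close>, the goal shrinks to
      \<open>t * y powr s \<le> (t * y) powr s\<close>. The right side factors, which leaves
      \<open>t \<le> t powr s\<close>, true for \<open>0 < t < 1\<close> and
      \<open>s \<le> 1\<close>.\<close>
    have "t powr 1 \<le> t powr s"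
      using t s by (intro powr_mono') auto
    then have "t * y powr s \<le> t powr s * y powr s"
      using t by (intro mult_right_mono) auto
    then show ?thesis
      using True t xy by (simp add: powr_mult)
  next
    case False
    then show ?thesis
      using concave_onD[OF pos, of t x y] t xy by auto
  qed
qed auto

lemma mono_on_share:
  fixes u :: real
  assumes "0 < u"
  shows "mono_on {0..} (\<lambda>w. w / (u + w))"
proof (rule mono_onI)
  fix r s :: real
  assume "r \<in> {0..}" "s \<in> {0..}" "r \<le> s"
  \<comment> \<open>Clearing the positive denominators leaves
    \<open>u * r \<le> u * s\<close>.\<close>
  then show "r / (u + r) \<le> s / (u + s)"
    using assms by (auto simp: divide_simps algebra_simps)
qed

lemma concave_on_share:
  fixes u :: real
  assumes "0 < u"
  shows "concave_on {0..} (\<lambda>w. w / (u + w))"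
proof (rule f''_le0_imp_concave)
  fix w :: real
  assume "w \<in> {0..}"
  then have pos: "u + w > 0"
    using assms by simp
  then show "((\<lambda>w. w / (u + w)) has_real_derivative u / (u + w)^2) (at w)"
    by (auto intro!: derivative_eq_intros simp: power2_eq_square)
  \<comment> \<open>This is \<open>-2 * u / (u + w)^3\<close>, left in the shape that the quotient
    rule produces. Because \<open>u > 0\<close>, the endpoint \<open>w = 0\<close> is no exception
    here.\<close>
  show "((\<lambda>w. u / (u + w)^2) has_real_derivative
          - (u * (2 * (u + w))) / ((u + w)^2 * (u + w)^2)) (at w)"
    using pos by (auto intro!: derivative_eq_intros)
  show "- (u * (2 * (u + w))) / ((u + w)^2 * (u + w)^2) \<le> 0"
    using pos assms by simp
qed auto

lemma convex_unit_cube: "convex (unit_cube :: (real ^ 'm) set)"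
  by (auto simp: convex_def unit_cube_def intro: convex_bound_le)

lemma cnl_W_nonneg:
  assumes "\<And>i. \<alpha> t i n \<ge> 0" "x \<in> unit_cube"
  shows "cnl_W \<sigma> \<alpha> v t n x \<ge> 0"
  using assms by (auto simp: cnl_W_def cnl_V_def unit_cube_def intro!: sum_nonneg)

lemma mono_cnl_W:
  assumes "\<And>i. \<alpha> t i n \<ge> 0"
  shows "mono (cnl_W \<sigma> \<alpha> v t n)"
  using assms
  by (auto simp: cnl_W_def cnl_V_def less_eq_vec_def intro!: monoI sum_mono mult_left_mono)

text \<open>Linearity makes the concavity inequality an equality.\<close>

lemma concave_on_cnl_W:
  assumes "convex S"
  shows "concave_on S (cnl_W \<sigma> \<alpha> v t n)"
  using assms
  by (auto simp: concave_on_iff cnl_W_def sum_distrib_left algebra_simps simp flip: sum.distrib)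

theorem proposition3:
  fixes q U :: "'t::finite \<Rightarrow> real"
    and \<sigma> :: "'t \<Rightarrow> 'n::finite \<Rightarrow> real"
    and \<alpha> :: "'t \<Rightarrow> 'm::finite \<Rightarrow> 'n \<Rightarrow> real"
    and v :: "'t \<Rightarrow> 'm \<Rightarrow> real"
  assumes q_pos: "\<And>t. q t > 0"
    and U_pos: "\<And>t. U t > 0"
    and sigma_pos: "\<And>t n. 0 < \<sigma> t n"
    and sigma_le: "\<And>t n. \<sigma> t n \<le> 1"
    and alpha_nonneg: "\<And>t i n. \<alpha> t i n \<ge> 0"
    and alpha_sum: "\<And>t i. (\<Sum>n\<in>UNIV. \<alpha> t i n) = 1"
  shows "(\<forall>x\<in>unit_cube. captured_demand q U \<sigma> \<alpha> v x =
            (\<Sum>t\<in>UNIV. q t) - (\<Sum>t\<in>UNIV. q t * U t / (U t + cnl_inclusive \<sigma> \<alpha> v t x)))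
       \<and> mono_on unit_cube (captured_demand q U \<sigma> \<alpha> v)
       \<and> concave_on unit_cube (captured_demand q U \<sigma> \<alpha> v)"
proof (intro conjI ballI)
  let ?S = "unit_cube :: (real ^ 'm) set"
  let ?W = "cnl_W \<sigma> \<alpha> v" and ?Z = "cnl_inclusive \<sigma> \<alpha> v"
  have W: "?W t n \<in> ?S \<rightarrow> {0..}" for t n
    using alpha_nonneg by (auto intro: cnl_W_nonneg)
  have Z: "?Z t \<in> ?S \<rightarrow> {0..}" for t
    by (auto simp: cnl_inclusive_def intro!: sum_nonneg)
  have mono_Z: "mono_on ?S (?Z t)" for t
    unfolding cnl_inclusive_def
  proof (intro mono_on_sum_fun mono_onI)
    fix n x y
    assume "x \<in> ?S" "y \<in> ?S" "x \<le> y"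
    then show "?W t n x powr \<sigma> t n \<le> ?W t n y powr \<sigma> t n"
      using W sigma_pos[of t n] monoD[OF mono_cnl_W[of \<alpha> t n \<sigma> v]] alpha_nonneg
      by (intro mono_onD[OF mono_on_powr]) (auto simp: less_imp_le)
  qed
  \<comment> \<open>For each nest the power is the outer function and \<open>?W t n\<close> the
    inner one; \<open>W\<close> keeps the bases in \<open>{0..}\<close>, where the power is concave
    and nondecreasing.\<close>
  have concave_Z: "concave_on ?S (?Z t)" for t
    unfolding cnl_inclusive_def
    using sigma_pos[of t] sigma_le[of t]
    by (intro concave_on_sum_fun convex_unit_cube concave_on_powr mono_on_powr
        concave_on_compose_mono[OF concave_on_cnl_W _ _ W]) (auto simp: less_imp_le)
  show "captured_demand q U \<sigma> \<alpha> v x = (\<Sum>t\<in>UNIV. q t) - (\<Sum>t\<in>UNIV. q t * U t / (U t + ?Z t x))"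
    if "x \<in> ?S" for x
  proof -
    \<comment> \<open>This is \<open>z / (u + z) = 1 - u / (u + z)\<close> scaled by
      \<open>q t\<close>; it rests on the denominator being nonzero.\<close>
    have "q t * (?Z t x / (U t + ?Z t x)) = q t - q t * U t / (U t + ?Z t x)" for t
    proof -
      have "0 < U t + ?Z t x"
        using Z that U_pos[of t] by (fastforce intro: add_pos_nonneg)
      then show ?thesis
        by (simp add: field_simps)
    qed
    then show ?thesis
      by (simp add: captured_demand_def sum_subtractf)
  qed
  \<comment> \<open>The order on vectors is componentwise, so this includes monotonicity in each
    single coordinate.\<close>
  show "mono_on ?S (captured_demand q U \<sigma> \<alpha> v)"
    unfolding captured_demand_def
  proof (intro mono_on_sum_fun mono_onI mult_left_mono)
    fix t x y
    assume "x \<in> ?S" "y \<in> ?S" "x \<le> y"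
    then show "?Z t x / (U t + ?Z t x) \<le> ?Z t y / (U t + ?Z t y)"
      using Z by (intro mono_onD[OF mono_on_share[OF U_pos]] mono_onD[OF mono_Z]) auto
  qed (simp add: less_imp_le q_pos)
  \<comment> \<open>Each customer type contributes a positive multiple of the share function
    composed with the concave \<open>?Z t\<close>.\<close>
  show "concave_on ?S (captured_demand q U \<sigma> \<alpha> v)"
    unfolding captured_demand_def
    by (intro concave_on_sum_fun convex_unit_cube concave_on_cmul less_imp_le[OF q_pos]
        concave_on_compose_mono[OF concave_Z concave_on_share[OF U_pos] mono_on_share[OF U_pos] Z])
qed

end
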